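(* If $P$ is a moderately meet continuous quasiexact poset, then $\sigma(P)\subseteq\tau_{wwb}(P)=\tau_{wf}(P)$, where $\sigma(P)$ is the Scott topology, $\tau_{wwb}(P)$ the weak way-below topology and $\tau_{wf}(P)$ the wf topology on $P$.
   Context: Let $P$ be a poset. For $A\subseteq P$, $\uparrow A=\{x\in P: y\le x \text{ for some } y\in A\}$ and $\downarrow A=\{x\in P: x\le y\text{ for some }y\in A\}$; write $\uparrow x,\downarrow x$ for $A=\{x\}$. Directed sets are nonempty. Weak way-below: for $x,y\in P$, $x\ll_w y$ iff for every directed $D\subseteq P$ with $\bigvee D=y$ (supremum exists and equals $y$), $D\cap\uparrow x\ne\varnothing$. For $G\subseteq P$ and $y\in P$, $G\ll_w y$ iff for every directed $D\subseteq P$ with $\bigvee D=y$, $D\cap\uparrow G\neq\varnothing$. $\mathrm{fin}_w(x)=\{F\subseteq P: F\text{ finite}, F\ll_w x\}$. A nonempty family $\mathcal F$ of subsets of $P$ is directed if for all $F_1,F_2\in\mathcal F$ there is $F_3\in\mathcal F$ with $F_3\subseteq\uparrow F_1\cap\uparrow F_2$. $P$ is quasiexact if for every $x\in P$ the family $\mathrm{fin}_w(x)$ is directed and $\bigcap\{\uparrow F: F\in\mathrm{fin}_w(x)\}=\uparrow x$. For $F\subseteq P$ put $U_F=\{a\in P: F\ll_w a\}$, and $U_x=U_{\{x\}}$. When $\{U_F: F\subseteq P\text{ finite}\}$ is a base of a topology on $P$, that topology is the wf topology $\tau_{wf}(P)$ (every quasiexact poset admits it). When $\{U_x: x\in P\}$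 is a base of a topology on $P$, that topology is the weak way-below topology $\tau_{wwb}(P)$; part of the claim is that it exists. A poset $P$ admitting the wf topology is moderately meet continuous if for every $x\in P$ and every directed $D\subseteq P$ (with existing supremum), $x\le\bigvee D$ implies $x\in\mathrm{cl}_{\tau_{wf}}(\downarrow D\cap\downarrow x)$, the closure taken in $\tau_{wf}(P)$. A set $U\subseteq P$ is Scott open if $U=\uparrow U$ and, for every directed $D$ whose supremum exists, $\bigvee D\in U$ implies $D\cap U\ne\varnothing$; the Scott open sets form the Scott topology $\sigma(P)$. *)

theory Defs
  imports "HOL-Analysis.Abstract_Topology" "HOL-Library.Lub_Glb"
begin

text \<open>A poset is a type of class \<open>order\<close>. Properties of the poset itself are
  predicates on its type token; suprema that need not exist are handled by the
  relation \<^const>\<open>isLub\<close> relative to the whole type.\<close>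

definition up_set :: "'a::order set \<Rightarrow> 'a set" where
  "up_set A = {x. \<exists>y\<in>A. y \<le> x}"

definition down_set :: "'a::order set \<Rightarrow> 'a set" where
  "down_set A = {x. \<exists>y\<in>A. x \<le> y}"

definition directed :: "'a::order set \<Rightarrow> bool" where
  "directed D \<longleftrightarrow> D \<noteq> {} \<and> (\<forall>x\<in>D. \<forall>y\<in>D. \<exists>z\<in>D. x \<le> z \<and> y \<le> z)"

abbreviation is_sup :: "'a::order set \<Rightarrow> 'a \<Rightarrow> bool" where
  "is_sup D s \<equiv> isLub UNIV D s"

lemma is_sup_iff:
  "is_sup D s \<longleftrightarrow> (\<forall>d\<in>D. d \<le> s) \<and> (\<forall>u. (\<forall>d\<in>D. d \<le> u) \<longrightarrow> s \<le> u)"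
  by (auto simp: isLub_def leastP_def isUb_def setle_def setge_def)

definition weak_way_below :: "'a::order \<Rightarrow> 'a \<Rightarrow> bool" where
  "weak_way_below x y \<longleftrightarrow> (\<forall>D. directed D \<and> is_sup D y \<longrightarrow> D \<inter> up_set {x} \<noteq> {})"

definition set_weak_way_below :: "'a::order set \<Rightarrow> 'a \<Rightarrow> bool" where
  "set_weak_way_below G y \<longleftrightarrow> (\<forall>D. directed D \<and> is_sup D y \<longrightarrow> D \<inter> up_set G \<noteq> {})"

lemma set_weak_way_below_singleton: "set_weak_way_below {x} y \<longleftrightarrow> weak_way_below x y"
  by (simp add: set_weak_way_below_def weak_way_below_def)

definition fin_w :: "'a::order \<Rightarrow> 'a set set" where
  "fin_w x = {F. finite F \<and> set_weak_way_below F x}"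

definition directed_family :: "'a::order set set \<Rightarrow> bool" where
  "directed_family \<F> \<longleftrightarrow> \<F> \<noteq> {} \<and>
     (\<forall>F1\<in>\<F>. \<forall>F2\<in>\<F>. \<exists>F3\<in>\<F>. F3 \<subseteq> up_set F1 \<inter> up_set F2)"

definition quasiexact :: "'a::order itself \<Rightarrow> bool" where
  "quasiexact _ \<longleftrightarrow>
     (\<forall>x::'a. directed_family (fin_w x) \<and> (\<Inter>F\<in>fin_w x. up_set F) = up_set {x})"

text \<open>\<open>base_on_UNIV \<B>\<close>: the unions of members of \<open>\<B>\<close> are the open sets of a topology whose
  underlying set is the whole type. \<^const>\<open>istopology\<close> alone does not ensure that the whole type
  is open, hence the covering condition.\<close>

definition base_on_UNIV :: "'a set set \<Rightarrow> bool" where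
  "base_on_UNIV \<B> \<longleftrightarrow> istopology (arbitrary union_of (\<lambda>U. U \<in> \<B>)) \<and> \<Union>\<B> = UNIV"

text \<open>Only meaningful when \<open>base_on_UNIV \<B>\<close> holds.\<close>

definition topology_with_base :: "'a set set \<Rightarrow> 'a topology" where
  "topology_with_base \<B> = topology (arbitrary union_of (\<lambda>U. U \<in> \<B>))"

lemma openin_topology_with_base:
  assumes "base_on_UNIV \<B>"
  shows "openin (topology_with_base \<B>) U \<longleftrightarrow> (\<exists>\<U>\<subseteq>\<B>. U = \<Union>\<U>)"
  using assms
  by (auto simp: base_on_UNIV_def topology_with_base_def union_of_def arbitrary_def)

lemma topspace_topology_with_base:
  assumes "base_on_UNIV \<B>"
  shows "topspace (topology_with_base \<B>) = UNIV"
proof -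
  have "openin (topology_with_base \<B>) (\<Union>\<B>)"
    using openin_topology_with_base[OF assms] by blast
  then show ?thesis
    using assms openin_subset unfolding base_on_UNIV_def by fastforce
qed

definition U_set :: "'a::order set \<Rightarrow> 'a set" where
  "U_set F = {a. set_weak_way_below F a}"

definition wf_base :: "'a::order set set" where
  "wf_base = {U_set F | F. finite F}"

definition wwb_base :: "'a::order set set" where
  "wwb_base = {U_set {x} | x. True}"

definition admits_wf_topology :: "'a::order itself \<Rightarrow> bool" where
  "admits_wf_topology _ \<longleftrightarrow> base_on_UNIV (wf_base :: 'a set set)"

definition wf_topology :: "'a::order topology" where
  "wf_topology = topology_with_base wf_base"

definition admits_wwb_topology :: "'a::order itself \<Rightarrow> bool" where
  "admits_wwb_topology _ \<longleftrightarrow> base_on_UNIV (wwb_base :: 'a set set)"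

definition wwb_topology :: "'a::order topology" where
  "wwb_topology = topology_with_base wwb_base"

definition moderately_meet_continuous :: "'a::order itself \<Rightarrow> bool" where
  "moderately_meet_continuous T \<longleftrightarrow> admits_wf_topology T \<and>
     (\<forall>(x::'a) D s. directed D \<and> is_sup D s \<and> x \<le> s \<longrightarrow>
        x \<in> wf_topology closure_of (down_set D \<inter> down_set {x}))"

definition scott_open :: "'a::order set \<Rightarrow> bool" where
  "scott_open U \<longleftrightarrow> U = up_set U \<and>
     (\<forall>D s. directed D \<and> is_sup D s \<and> s \<in> U \<longrightarrow> D \<inter> U \<noteq> {})"

definition scott_topology :: "'a::order topology" where
  "scott_topology = topology scott_open"

lemma up_set_eq_iff: "U = up_set U \<longleftrightarrow> (\<forall>x y. x \<in> U \<and> x \<le> y \<longrightarrow> y \<in> U)"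
  by (auto simp: up_set_def)

lemma istopology_scott_open: "istopology (scott_open :: 'a::order set \<Rightarrow> bool)"
  unfolding istopology_def
proof (intro conjI allI impI)
  fix S T :: "'a set"
  assume S: "scott_open S" and T: "scott_open T"
  have up: "\<And>x y. x \<in> S \<Longrightarrow> x \<le> y \<Longrightarrow> y \<in> S" "\<And>x y. x \<in> T \<Longrightarrow> x \<le> y \<Longrightarrow> y \<in> T"
    using S T unfolding scott_open_def up_set_eq_iff by blast+
  have "D \<inter> (S \<inter> T) \<noteq> {}" if D: "directed D" "is_sup D s" "s \<in> S \<inter> T" for D s
  proof -
    obtain a b where "a \<in> D" "a \<in> S" "b \<in> D" "b \<in> T"
      using S T D unfolding scott_open_def by blast
    moreover from this obtain c where "c \<in> D" "a \<le> c" "b \<le> c"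
      using D(1) unfolding directed_def by blast
    ultimately show ?thesis
      using up by blast
  qed
  then show "scott_open (S \<inter> T)"
    using up unfolding scott_open_def up_set_eq_iff by blast
next
  fix \<K> :: "'a set set"
  assume K: "\<forall>K\<in>\<K>. scott_open K"
  have "y \<in> \<Union>\<K>" if "x \<in> \<Union>\<K>" "x \<le> y" for x y
    using that K unfolding scott_open_def up_set_eq_iff by blast
  moreover have "D \<inter> \<Union>\<K> \<noteq> {}" if D: "directed D" "is_sup D s" "s \<in> \<Union>\<K>" for D s
  proof -
    obtain K where "K \<in> \<K>" "s \<in> K"
      using D(3) by blast
    then have "D \<inter> K \<noteq> {}"
      using K D(1,2) unfolding scott_open_def by blast
    then show ?thesis
      using \<open>K \<in> \<K>\<close> by blast
  qed
  ultimately show "scott_open (\<Union>\<K>)"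
    unfolding scott_open_def up_set_eq_iff by blast
qed

lemma openin_scott_topology: "openin scott_topology U \<longleftrightarrow> scott_open U"
  by (simp add: scott_topology_def istopology_scott_open)

end

(* Moderate meet continuity turns F <<_w x, for finite F, into y <<_w x for some y in F: otherwise
   each y in F has a directed set D_y with supremum x missing the up-set of y, and descending
   inside the wf open set U_F, once for each y, yields a point of U_F lying below all the D_y, hence
   above no y in F, although U_F is contained in the up-set of F. So U_F is the union of the U_y
   with y in F, and the two topologies agree. Quasiexactness then makes {y. y <<_w x} directed with
   supremum x, so that a Scott open set containing x contains some y <<_w x, and with it U_y. *)
theory Submission
  imports Defs
begin

lemma set_weak_way_below_mono:
  assumes "set_weak_way_below F x" "F \<subseteq> up_set G"
  shows "set_weak_way_below G x"
proof -
  have "up_set F \<subseteq> up_set G"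
    using assms(2) order_trans unfolding up_set_def by blast
  then show ?thesis
    using assms(1) unfolding set_weak_way_below_def by blast
qed

lemma U_set_mono: "F \<subseteq> G \<Longrightarrow> U_set F \<subseteq> U_set G"
  unfolding U_set_def by (auto elim!: set_weak_way_below_mono intro!: bexI simp: up_set_def)

text \<open>The singleton \<open>{x}\<close> is itself directed with supremum \<open>x\<close>, so
  it has to meet \<open>up_set F\<close>.\<close>

lemma U_set_subset_up_set: "U_set F \<subseteq> up_set F"
proof
  fix x assume "x \<in> U_set F"
  moreover have "directed {x}" "is_sup {x} x"
    unfolding directed_def is_sup_iff by auto
  ultimately show "x \<in> up_set F"
    unfolding U_set_def set_weak_way_below_def by blast
qed

lemma openin_wf_topology_iff:
  assumes "admits_wf_topology TYPE('a::order)"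
  shows "openin wf_topology S \<longleftrightarrow> (arbitrary union_of (\<lambda>U. U \<in> wf_base)) (S :: 'a set)"
  using assms
  by (simp add: admits_wf_topology_def base_on_UNIV_def wf_topology_def topology_with_base_def)

lemma openin_wf_topology_U_set:
  assumes "admits_wf_topology TYPE('a::order)" "finite F"
  shows "openin wf_topology (U_set F :: 'a set)"
proof -
  have "U_set F \<in> wf_base"
    unfolding wf_base_def using assms(2) by blast
  then show ?thesis
    by (auto simp: openin_wf_topology_iff[OF assms(1)] arbitrary_union_of_alt)
qed

text \<open>Induction on \<open>G\<close>, moving the witness down inside \<open>V\<close> once per
  element. Memberships in the down-sets treated earlier survive each move, because down-sets are
  closed under going down.\<close>

lemma moderately_meet_continuous_common_lower_point:
  fixes x :: "'a::order"
  assumes mmc: "moderately_meet_continuous TYPE('a)"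
    and V: "openin wf_topology V" "x \<in> V"
    and "finite G"
    and D: "\<And>y. y \<in> G \<Longrightarrow> directed (D y) \<and> is_sup (D y) x"
  shows "\<exists>z\<in>V. z \<le> x \<and> (\<forall>y\<in>G. z \<in> down_set (D y))"
  using \<open>finite G\<close> D
proof (induction G)
  case empty
  then show ?case using V(2) by blast
next
  case (insert y G)
  then obtain z where z: "z \<in> V" "z \<le> x" "\<forall>y\<in>G. z \<in> down_set (D y)"
    by blast
  \<comment> \<open>Moderate meet continuity is applied at the current witness \<open>z\<close>, not
    at \<open>x\<close>; this is possible because \<open>z \<le> x\<close> and \<open>x\<close> is
    the supremum of \<open>D y\<close>. Then \<open>V\<close>, a neighbourhood of \<open>z\<close>,
    meets the set on the right.\<close>
  have "z \<in> wf_topology closure_of (down_set (D y) \<inter> down_set {z})"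
    using mmc insert.prems z(2) unfolding moderately_meet_continuous_def by blast
  then obtain z' where z': "z' \<in> down_set (D y)" "z' \<le> z" "z' \<in> V"
    using V(1) z(1) unfolding in_closure_of down_set_def by blast
  have "z' \<le> x" "\<forall>y\<in>G. z' \<in> down_set (D y)"
    using z z'(2) order_trans unfolding down_set_def by blast+
  then show ?case
    using z' by blast
qed

text \<open>Finiteness of \<open>F\<close> enters twice: it makes \<open>U_set F\<close> open in the
  wf topology, and it lets the descent through the sets \<open>D y\<close> terminate.\<close>

lemma weak_way_below_member:
  fixes x :: "'a::order"
  assumes mmc: "moderately_meet_continuous TYPE('a)"
    and "finite F" "set_weak_way_below F x"
  shows "\<exists>y\<in>F. weak_way_below y x"
proof (rule ccontr)
  assume "\<not> ?thesis"
  then have "\<forall>y\<in>F. \<exists>D. directed D \<and> is_sup D x \<and> D \<inter> up_set {y} = {}"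
    unfolding weak_way_below_def by blast
  then obtain D where D: "\<And>y. y \<in> F \<Longrightarrow> directed (D y) \<and> is_sup (D y) x"
    and disj: "\<And>y. y \<in> F \<Longrightarrow> D y \<inter> up_set {y} = {}"
    by metis
  have "openin wf_topology (U_set F)"
    using mmc openin_wf_topology_U_set[OF _ \<open>finite F\<close>]
    unfolding moderately_meet_continuous_def by blast
  moreover have "x \<in> U_set F"
    using assms(3) unfolding U_set_def by blast
  ultimately have "\<exists>z\<in>U_set F. z \<le> x \<and> (\<forall>y\<in>F. z \<in> down_set (D y))"
    by (rule moderately_meet_continuous_common_lower_point[OF mmc _ _ \<open>finite F\<close> D])
  then obtain z where z: "z \<in> U_set F" "\<forall>y\<in>F. z \<in> down_set (D y)"
    by blast
  then obtain y where "y \<in> F" "y \<le> z"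
    using U_set_subset_up_set[of F] unfolding up_set_def by blast
  moreover from this z(2) obtain d where "d \<in> D y" "z \<le> d"
    unfolding down_set_def by blast
  ultimately show False
    using disj order_trans unfolding up_set_def by blast
qed

text \<open>Directedness passes from \<open>fin_w x\<close> to \<open>W\<close> because singletons
  of elements of \<open>W\<close> belong to \<open>fin_w x\<close> and, conversely, every member of
  \<open>fin_w x\<close> meets \<open>W\<close>.\<close>

lemma directed_is_sup_weak_way_below:
  fixes x :: "'a::order"
  assumes "quasiexact TYPE('a)" and mmc: "moderately_meet_continuous TYPE('a)"
  defines "W \<equiv> {y. weak_way_below y x}"
  shows "directed W" "is_sup W x"
proof -
  have dir: "directed_family (fin_w x)" and Int: "(\<Inter>F\<in>fin_w x. up_set F) = up_set {x}"
    using assms(1) unfolding quasiexact_def by blast+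
  have meets: "\<exists>y\<in>F. y \<in> W" if "F \<in> fin_w x" for F
    using that weak_way_below_member[OF mmc] unfolding fin_w_def W_def by blast
  have sing: "{y} \<in> fin_w x" if "y \<in> W" for y
    using that by (simp add: fin_w_def W_def set_weak_way_below_singleton)
  have "W \<noteq> {}"
    using dir meets unfolding directed_family_def by blast
  moreover have "\<exists>z\<in>W. y1 \<le> z \<and> y2 \<le> z" if y: "y1 \<in> W" "y2 \<in> W" for y1 y2
  proof -
    obtain F where "F \<in> fin_w x" "F \<subseteq> up_set {y1} \<inter> up_set {y2}"
      using dir sing[OF y(1)] sing[OF y(2)] unfolding directed_family_def by blast
    then show ?thesis
      using meets unfolding up_set_def by blast
  qed
  ultimately show "directed W"
    unfolding directed_def by blast
  have "y \<le> x" if "y \<in> W" for y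
  proof -
    have "x \<in> up_set {x}" by (simp add: up_set_def)
    then have "x \<in> up_set {y}"
      using Int sing[OF that] by blast
    then show ?thesis by (simp add: up_set_def)
  qed
  moreover have "x \<le> u" if "\<forall>y\<in>W. y \<le> u" for u
  proof -
    \<comment> \<open>Each \<open>F\<close> in \<open>fin_w x\<close> has an element in
      \<open>W\<close>, and \<open>u\<close> is above it.\<close>
    have "u \<in> (\<Inter>F\<in>fin_w x. up_set F)"
      using meets that unfolding up_set_def by blast
    then show ?thesis
      unfolding Int by (simp add: up_set_def)
  qed
  ultimately show "is_sup W x"
    unfolding is_sup_iff by blast
qed

lemma U_set_eq_Union_singletons:
  fixes F :: "'a::order set"
  assumes "moderately_meet_continuous TYPE('a)" "finite F"
  shows "U_set F = (\<Union>y\<in>F. U_set {y})"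
proof
  show "U_set F \<subseteq> (\<Union>y\<in>F. U_set {y})"
    using weak_way_below_member[OF assms]
    unfolding U_set_def set_weak_way_below_singleton by blast
  show "(\<Union>y\<in>F. U_set {y}) \<subseteq> U_set F"
    using U_set_mono[of _ F] by blast
qed

text \<open>Stated for the predicates rather than for the topologies, since
  \<open>wwb_topology\<close> is meaningful only once its existence is known. Rewriting with this
  equation transfers existence from the wf topology and also identifies the two.\<close>

lemma arbitrary_union_of_wwb_base_eq:
  assumes "moderately_meet_continuous TYPE('a::order)"
  shows "arbitrary union_of (\<lambda>U. U \<in> (wwb_base :: 'a set set)) =
         arbitrary union_of (\<lambda>U. U \<in> wf_base)"
proof -
  have refine: "\<exists>V\<in>wwb_base. x \<in> V \<and> V \<subseteq> U" if "U \<in> wf_base" "x \<in> U" for U and x :: 'a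
  proof -
    obtain F where F: "finite F" "U = U_set F"
      using \<open>U \<in> wf_base\<close> unfolding wf_base_def by blast
    have "U = (\<Union>y\<in>F. U_set {y})"
      unfolding F(2) by (rule U_set_eq_Union_singletons[OF assms F(1)])
    then show ?thesis
      using \<open>x \<in> U\<close> unfolding wwb_base_def by blast
  qed
  have sub: "wwb_base \<subseteq> (wf_base :: 'a set set)"
  proof
    fix U :: "'a set" assume "U \<in> wwb_base"
    then obtain x where "U = U_set {x}"
      unfolding wwb_base_def by blast
    then show "U \<in> wf_base"
      unfolding wf_base_def by (simp add: exI[of _ "{x}"])
  qed
  show ?thesis
  proof (intro ext iffI)
    fix S :: "'a set"
    assume "(arbitrary union_of (\<lambda>U. U \<in> wwb_base)) S"
    then show "(arbitrary union_of (\<lambda>U. U \<in> wf_base)) S"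
      using sub unfolding arbitrary_union_of_alt by blast
  next
    fix S :: "'a set"
    assume S: "(arbitrary union_of (\<lambda>U. U \<in> wf_base)) S"
    show "(arbitrary union_of (\<lambda>U. U \<in> wwb_base)) S"
      unfolding arbitrary_union_of_alt
    proof
      fix x assume "x \<in> S"
      then obtain U where "U \<in> wf_base" "x \<in> U" "U \<subseteq> S"
        using S unfolding arbitrary_union_of_alt by blast
      then show "\<exists>V. V \<in> wwb_base \<and> x \<in> V \<and> V \<subseteq> S"
        using refine[of U x] by blast
    qed
  qed
qed

text \<open>For \<open>x\<close> in \<open>U\<close>, the elements weakly way below \<open>x\<close>
  form a directed set with supremum \<open>x\<close>, so one of them, \<open>y\<close>, lies in
  \<open>U\<close>; then \<open>U_set {y}\<close> is a basic neighbourhood of \<open>x\<close>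
  inside \<open>up_set {y}\<close>, hence inside \<open>U\<close>.\<close>

lemma scott_open_imp_union_of_wwb_base:
  fixes U :: "'a::order set"
  assumes "quasiexact TYPE('a)" "moderately_meet_continuous TYPE('a)" "scott_open U"
  shows "(arbitrary union_of (\<lambda>V. V \<in> wwb_base)) U"
  unfolding arbitrary_union_of_alt
proof
  fix x assume "x \<in> U"
  with assms(3) directed_is_sup_weak_way_below[OF assms(1,2)]
  obtain y where y: "weak_way_below y x" "y \<in> U"
    unfolding scott_open_def by blast
  have "up_set {y} \<subseteq> U"
    using assms(3) \<open>y \<in> U\<close> unfolding scott_open_def up_set_def by blast
  then have "U_set {y} \<subseteq> U"
    using U_set_subset_up_set by blast
  moreover have "x \<in> U_set {y}"
    using y(1) by (simp add: U_set_def set_weak_way_below_singleton)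
  moreover have "U_set {y} \<in> wwb_base"
    unfolding wwb_base_def by blast
  ultimately show "\<exists>V. V \<in> wwb_base \<and> x \<in> V \<and> V \<subseteq> U"
    by blast
qed

theorem theorem4p11:
  assumes "quasiexact TYPE('a::order)"
    and "moderately_meet_continuous TYPE('a)"
  shows "admits_wwb_topology TYPE('a)
    \<and> {U :: 'a set. openin scott_topology U} \<subseteq> {U. openin wwb_topology U}
    \<and> (wwb_topology :: 'a topology) = wf_topology"
proof -
  note eq = arbitrary_union_of_wwb_base_eq[OF assms(2)]
  have wf: "admits_wf_topology TYPE('a)"
    using assms(2) unfolding moderately_meet_continuous_def by blast
  have top: "(wwb_topology :: 'a topology) = wf_topology"
    by (simp add: wwb_topology_def wf_topology_def topology_with_base_def eq)
  \<comment> \<open>The covering condition in \<open>base_on_UNIV\<close>: the whole type is open in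
    the wf topology, hence a union of members of \<open>wwb_base\<close>.\<close>
  have "(arbitrary union_of (\<lambda>U. U \<in> (wwb_base :: 'a set set))) UNIV"
    using wf openin_topspace[of "wf_topology :: 'a topology"] topspace_topology_with_base
    unfolding eq openin_wf_topology_iff[OF wf]
    by (metis admits_wf_topology_def wf_topology_def)
  then have "\<Union>(wwb_base :: 'a set set) = UNIV"
    unfolding arbitrary_union_of_alt by blast
  then have "admits_wwb_topology TYPE('a)"
    using wf by (simp add: admits_wwb_topology_def admits_wf_topology_def base_on_UNIV_def eq)
  moreover have "openin wwb_topology U" if "openin scott_topology U" for U :: "'a set"
    using scott_open_imp_union_of_wwb_base[OF assms] that
    unfolding top openin_wf_topology_iff[OF wf] openin_scott_topology eq by blast
  ultimately show ?thesis
    using top by blast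
qed

end
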